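(* Let $k\geq 1$ be an integer. Then the metric dimension of the Andrásfai graph $And(k)$ is $k$, i.e. $\dim_M(And(k))=k$.
   Context: All graphs are finite, simple and undirected. For a connected graph $G$, $d(x,y)$ denotes the length of a shortest path between vertices $x$ and $y$. A set $W\subseteq V(G)$ is a resolving set for $G$ if for each pair of distinct vertices $u,v\in V(G)$ there exists $t\in W$ with $d(u,t)\neq d(v,t)$. The metric dimension $\dim_M(G)$ is the minimum cardinality of a resolving set for $G$. For an integer $k\geq 1$, the Andrásfai graph $And(k)$ is the Cayley graph $Cay(\mathbb{Z}_{3k-1},S)$ of the additive group of integers modulo $3k-1$ with $S=\{1,4,7,\ldots,3k-2\}$ (the classes of the integers in $\{1,\ldots,3k-1\}$ congruent to $1$ modulo $3$; $S=-S$ and $0\notin S$). That is, its vertex set is $\mathbb{Z}_{3k-1}$ and two vertices $u,v$ are adjacent if and only if $u-v\in S$. *)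

theory Defs
  imports "Graph_Theory.Graph_Theory" "HOL-Algebra.Elementary_Groups"
begin

text \<open>
  Following \<^theory>\<open>Graph_Theory.Digraph\<close>, a finite simple undirected graph is a finite symmetric
  loop-free digraph without parallel arcs, i.e. the locale \<^locale>\<open>graph\<close>.
\<close>

context graph
begin

text \<open>
  With unit weights the cost of a walk is its length, so this is the usual distance
  (with value \<open>\<infinity>\<close> when there is no walk at all).
\<close>
definition distance :: "'a \<Rightarrow> 'a \<Rightarrow> ereal" where
  "distance u v = \<mu> (\<lambda>_. 1) u v"

definition resolving_set :: "'a set \<Rightarrow> bool" where
  "resolving_set W \<longleftrightarrow> W \<subseteq> verts G \<and>
     (\<forall>u \<in> verts G. \<forall>v \<in> verts G. u \<noteq> v \<longrightarrow> (\<exists>t \<in> W. distance u t \<noteq> distance v t))"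

definition metric_dimension :: nat where
  "metric_dimension = (LEAST n. \<exists>W. resolving_set W \<and> card W = n)"

end

definition Cayley_graph :: "('a, 'b) monoid_scheme \<Rightarrow> 'a set \<Rightarrow> ('a, 'a \<times> 'a) pre_digraph" where
  "Cayley_graph A S =
     \<lparr> verts = carrier A,
       arcs = {(u, v). u \<in> carrier A \<and> v \<in> carrier A \<and> u \<otimes>\<^bsub>A\<^esub> inv\<^bsub>A\<^esub> v \<in> S},
       tail = fst, head = snd \<rparr>"

text \<open>
  \<^term>\<open>integer_mod_group n\<close> is the additive group of residues \<open>{0..<n}\<close>, so \<open>u \<otimes> inv v\<close> is
  \<open>(u - v) mod n\<close>. Since \<open>3 * k - 1\<close> is not congruent to 1 modulo 3, every element of the
  connection set is its own residue.
\<close>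
definition Andrasfai_connection_set :: "nat \<Rightarrow> int set" where
  "Andrasfai_connection_set k = {s \<in> {1..3 * int k - 1}. s mod 3 = 1}"

definition Andrasfai_graph :: "nat \<Rightarrow> (int, int \<times> int) pre_digraph" where
  "Andrasfai_graph k = Cayley_graph (integer_mod_group (3 * k - 1)) (Andrasfai_connection_set k)"

lemma verts_Andrasfai_graph:
  assumes "k \<ge> 1"
  shows "verts (Andrasfai_graph k) = {0..<3 * int k - 1}"
  using assms by (auto simp: Andrasfai_graph_def Cayley_graph_def carrier_integer_mod_group of_nat_diff)

lemma arcs_Andrasfai_graph:
  assumes "k \<ge> 1"
  shows "arcs (Andrasfai_graph k) =
    {(u, v). u \<in> {0..<3 * int k - 1} \<and> v \<in> {0..<3 * int k - 1} \<and>
       (u - v) mod (3 * int k - 1) \<in> Andrasfai_connection_set k}"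
proof -
  obtain N where N: "N = 3 * k - 1" "N \<noteq> 0" "3 * int k - 1 = int N"
    using assms by (simp add: of_nat_diff)
  have c: "carrier (integer_mod_group N) = {0..<int N}"
    using N(2) by (simp add: carrier_integer_mod_group)
  have d: "u \<otimes>\<^bsub>integer_mod_group N\<^esub> inv\<^bsub>integer_mod_group N\<^esub> v = (u - v) mod int N"
    if "v \<in> {0..<int N}" for u v
    using that N(2) by (simp add: c inv_integer_mod_group mult_integer_mod_group mod_simps)
  show ?thesis
    unfolding Andrasfai_graph_def Cayley_graph_def N(3) N(1)[symmetric]
    using d by (auto simp: c)
qed

lemma minus_in_Andrasfai_connection_set:
  assumes "k \<ge> 1" and "x mod (3 * int k - 1) \<in> Andrasfai_connection_set k"
  shows "(- x) mod (3 * int k - 1) \<in> Andrasfai_connection_set k"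
proof -
  let ?n = "3 * int k - 1"
  define r where "r = x mod ?n"
  have r: "1 \<le> r" "r < ?n" "r mod 3 = 1"
    using assms by (auto simp: r_def Andrasfai_connection_set_def)
  have "(- x) mod ?n = ?n - r"
    using r by (simp add: r_def zmod_zminus1_eq_if)
  moreover have "(?n - r) mod 3 = 1"
    using r(3) by presburger
  ultimately show ?thesis
    using r by (simp add: Andrasfai_connection_set_def)
qed

lemma graph_Andrasfai_graph:
  assumes "k \<ge> 1"
  shows "graph (Andrasfai_graph k)"
proof -
  let ?G = "Andrasfai_graph k"
  have th: "tail ?G = fst" "head ?G = snd"
    by (simp_all add: Andrasfai_graph_def Cayley_graph_def)
  note V = verts_Andrasfai_graph[OF assms]
  note A = arcs_Andrasfai_graph[OF assms]
  have fin: "finite (arcs ?G)"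
    by (rule finite_subset[of _ "verts ?G \<times> verts ?G"]) (auto simp: V A)
  have sym: "symmetric ?G"
    unfolding symmetric_def sym_def arcs_ends_def arc_to_ends_def th
    using minus_in_Andrasfai_connection_set[OF assms]
    by (force simp: A)
  show ?thesis
    using fin sym
    by unfold_locales
      (auto simp: th V A arc_to_ends_def Andrasfai_connection_set_def)
qed

end

theory Submission
  imports Defs
begin

text \<open>
  Write \<open>n = 3 * k - 1\<close>. If \<open>0 \<le> p < n\<close> is the offset \<open>v - u\<close> modulo \<open>n\<close>, then \<open>u\<close> and \<open>v\<close>
  are at distance 0 if \<open>p = 0\<close>, at distance 1 if \<open>p mod 3 = 1\<close>, and otherwise at distance 2, since
  every remaining offset is a sum modulo \<open>n\<close> of two elements of the connection set
  (\<open>Andrasfai_distance\<close>). A resolving set is therefore described by residues modulo 3 alone, with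
  the twist that \<open>n mod 3 = 2\<close>: going once around the cycle shifts the residues.

  Upper bound: the \<open>k\<close> multiples of 3 resolve. A vertex outside the set is adjacent to the elements
  that precede it in \<open>{0..<n}\<close> exactly if it is 1 modulo 3, and to the later ones exactly if it is
  2 modulo 3; so 0 separates different nonzero residues, and for two vertices of
  the same residue an element between them separates them.

  Lower bound: for \<open>0 < 3 * j < n\<close>, the vertices \<open>a\<close> and \<open>a + 3 * j\<close> are equally far from everything outside the arc
  from \<open>a\<close> to \<open>a + 3 * j\<close>, and also from the interior vertices \<open>a + 3 * i\<close> of the arc. So a
  resolving set \<open>W\<close> meets the arc elsewhere (\<open>resolving_set_hits_progression\<close>). In terms
  of the gaps between cyclically consecutive elements of \<open>W\<close>, this says that no gap exceeds 4
  (case \<open>j = 1\<close>) and that two gaps of length 4 cannot be separated only by gaps of length 3: the arc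
  from three before the end of the first long gap to three after the start of the second would meet
  \<open>W\<close> in interior vertices \<open>a + 3 * i\<close> only. Hence between any two gaps of length 4 there is one of
  length at most 2, the lengths exceed 3 by at most 1 in total, and
  \<open>n \<le> 3 * card W + 1\<close> (\<open>hitting_set_card_bound\<close>). As \<open>n = 3 * k - 1\<close>, this forces
  \<open>k \<le> card W\<close>.
\<close>

section \<open>Distances of at most two\<close>

context graph
begin

lemma distance_ge_if_walks_ge:
  assumes "\<And>p. awalk u p v \<Longrightarrow> d \<le> length p"
  shows "ereal (real d) \<le> distance u v"
proof -
  have "awalk_cost (\<lambda>_. 1) p = real (length p)" for p
    by (induction p) auto
  then show ?thesis
    using assms unfolding distance_def \<mu>_def by (auto intro!: INF_greatest)
qed

lemma distance_le_length:
  assumes "awalk u p v"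
  shows "distance u v \<le> ereal (real (length p))"
proof -
  have "awalk_cost (\<lambda>_. 1) p = real (length p)"
    by (induction p) auto
  then show ?thesis
    using min_cost_le_walk_cost[OF assms, of "\<lambda>_. 1"] by (simp add: distance_def)
qed

lemma distance_self:
  assumes "u \<in> verts G"
  shows "distance u u = 0"
  using distance_ge_if_walks_ge[of u u 0] distance_le_length[of u "[]" u] assms
  by (simp add: awalk_Nil_iff)

lemma distance_adjacent:
  assumes "u \<rightarrow> v"
  shows "distance u v = 1"
proof -
  obtain e where e: "e \<in> arcs G" "tail G e = u" "head G e = v"
    using assms by auto
  have "u \<noteq> v"
    using assms adj_not_same by blast
  then have "1 \<le> length p" if "awalk u p v" for p
    using that by (cases p) (auto simp: awalk_simps)
  then have "1 \<le> distance u v"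
    using distance_ge_if_walks_ge[of u v 1] by (simp add: one_ereal_def)
  moreover have "distance u v \<le> 1"
    using distance_le_length[of u "[e]" v] e head_in_verts[OF e(1)] by (simp add: awalk_simps one_ereal_def)
  ultimately show ?thesis by simp
qed

lemma distance_common_neighbour:
  assumes "u \<rightarrow> w" and "w \<rightarrow> v" and "u \<noteq> v" and "\<not> u \<rightarrow> v"
  shows "distance u v = 2"
proof -
  obtain e where e: "e \<in> arcs G" "tail G e = u" "head G e = w"
    using assms by auto
  obtain f where f: "f \<in> arcs G" "tail G f = w" "head G f = v"
    using assms by auto
  have "2 \<le> length p" if p: "awalk u p v" for p
  proof (cases p)
    case Nil
    then show ?thesis
      using p assms by (simp add: awalk_simps)
  next
    case (Cons a q)
    then show ?thesis
      using p assms(4) by (cases q) (auto simp: awalk_simps dest: in_arcs_imp_in_arcs_ends)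
  qed
  then have "2 \<le> distance u v"
    using distance_ge_if_walks_ge[of u v 2] by simp
  moreover have "distance u v \<le> 2"
    using distance_le_length[of u "[e, f]" v] e f head_in_verts[OF f(1)] by (simp add: awalk_simps)
  ultimately show ?thesis by simp
qed

end

section \<open>Distances in the Andrasfai graph\<close>

lemma mod_eq_add_modulus:
  fixes x n :: int
  assumes "- n \<le> x" and "x < 0"
  shows "x mod n = x + n"
  using assms mod_pos_pos_trivial[of "x + n" n] by simp

lemma Andrasfai_adjacent_iff:
  assumes "k \<ge> 1" and "u \<in> verts (Andrasfai_graph k)" and "v \<in> verts (Andrasfai_graph k)"
  shows "u \<rightarrow>\<^bsub>Andrasfai_graph k\<^esub> v \<longleftrightarrow> (v - u) mod (3 * int k - 1) mod 3 = 1"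
proof -
  let ?G = "Andrasfai_graph k" and ?n = "3 * int k - 1"
  have residue: "x mod ?n \<in> Andrasfai_connection_set k \<longleftrightarrow> x mod ?n mod 3 = 1" for x
  proof -
    have "0 \<le> x mod ?n" "x mod ?n < ?n"
      using assms(1) by simp_all
    moreover have "1 \<le> r" if "0 \<le> r" "r mod 3 = 1" for r :: int
      using that by presburger
    ultimately show ?thesis
      by (auto simp: Andrasfai_connection_set_def)
  qed
  have "tail ?G = fst" "head ?G = snd"
    by (simp_all add: Andrasfai_graph_def Cayley_graph_def)
  then have "u \<rightarrow>\<^bsub>?G\<^esub> v \<longleftrightarrow> (u - v) mod ?n \<in> Andrasfai_connection_set k"
    using assms by (auto simp: arcs_ends_conv arcs_Andrasfai_graph verts_Andrasfai_graph image_iff)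
  also have "\<dots> \<longleftrightarrow> (v - u) mod ?n \<in> Andrasfai_connection_set k"
    using minus_in_Andrasfai_connection_set[OF assms(1), of "u - v"]
      minus_in_Andrasfai_connection_set[OF assms(1), of "v - u"] by auto
  finally show ?thesis
    by (simp add: residue)
qed

text \<open>
  Distinct nonadjacent vertices have a common neighbour: an offset \<open>p\<close> that is 2 modulo 3 splits
  as \<open>1 + (p - 1)\<close>. If \<open>p\<close> is a multiple of 3, then \<open>p + n\<close> is 2 modulo 3, and it
  splits as \<open>(n - 1) + (p + 1)\<close>.
\<close>

lemma Andrasfai_distance:
  assumes k: "k \<ge> 1" and u: "u \<in> verts (Andrasfai_graph k)" and v: "v \<in> verts (Andrasfai_graph k)"
  shows "graph.distance (Andrasfai_graph k) u v =
    (if u = v then 0 else if (v - u) mod (3 * int k - 1) mod 3 = 1 then 1 else 2)"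
proof -
  let ?G = "Andrasfai_graph k"
  define n where "n = 3 * int k - 1"
  interpret graph ?G
    using graph_Andrasfai_graph[OF k] .
  have V: "verts ?G = {0..<n}"
    using verts_Andrasfai_graph[OF k] by (simp add: n_def)
  have n: "n > 0"
    using k by (simp add: n_def)
  note adj = Andrasfai_adjacent_iff[OF k, folded n_def]
  consider "u = v" | "u \<rightarrow>\<^bsub>?G\<^esub> v" | "u \<noteq> v" "\<not> u \<rightarrow>\<^bsub>?G\<^esub> v"
    by blast
  then show ?thesis
  proof cases
    case 1
    then show ?thesis
      using distance_self u by simp
  next
    case 2
    then show ?thesis
      using distance_adjacent[OF 2] adj_not_same adj[OF u v] by (auto simp: n_def)
  next
    case 3
    define p where "p = (v - u) mod n"
    have p: "0 \<le> p" "p < n" "p mod 3 \<noteq> 1"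
      using 3 n adj[OF u v] by (auto simp: p_def)
    have "p \<noteq> 0"
      using 3(1) u v n unfolding p_def V by (metis atLeastLessThan_iff eq_iff_diff_eq_0 mod_diff_cong
          mod_eq_0_iff_dvd mod_eq_dvd_iff mod_pos_pos_trivial)
    \<comment> \<open>A common neighbour is \<open>u + s\<close>, which leaves the step \<open>p - s\<close> modulo \<open>n\<close> to \<open>v\<close>.\<close>
    define s where "s = (if p mod 3 = 2 then 1 else n - 1)"
    have s: "0 \<le> s" "s < n" "s mod 3 = 1"
      using n unfolding s_def n_def by (simp_all split: if_split; presburger)+
    have ps: "(p - s) mod n mod 3 = 1"
    proof (cases "p mod 3 = 2")
      case True
      then have "1 \<le> p"
        using p(1) by presburger
      then have off: "(p - s) mod n = p - 1"
        using True p by (simp add: s_def)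
      show ?thesis
        using True unfolding off by presburger
    next
      case False
      then have "p mod 3 = 0"
        using p(3) by presburger
      then have "p + 1 < n"
        using p(2) unfolding n_def by presburger
      then have off: "(p - s) mod n = p + 1"
        using p False mod_eq_add_modulus[of n "p + 1 - n"] by (simp add: s_def algebra_simps)
      show ?thesis
        using \<open>p mod 3 = 0\<close> unfolding off by presburger
    qed
    define w where "w = (u + s) mod n"
    have w: "w \<in> verts ?G"
      using n by (simp add: w_def V)
    have "(w - u) mod n = s"
      using s by (simp add: w_def mod_simps)
    then have "u \<rightarrow>\<^bsub>?G\<^esub> w"
      using adj[OF u w] s by simp
    moreover have "(v - w) mod n = (p - s) mod n"
      by (simp add: w_def p_def mod_simps algebra_simps)
    then have "w \<rightarrow>\<^bsub>?G\<^esub> v"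
      using adj[OF w v] ps by simp
    ultimately have "distance u v = 2"
      using 3 distance_common_neighbour by blast
    then show ?thesis
      using 3 adj[OF u v] by (simp add: n_def)
  qed
qed

section \<open>Hitting progressions of step three\<close>

text \<open>
  The gap argument, on a line instead of a cycle: the points 0 to \<open>n - 1\<close> are read from left to right,
  with the imaginary element \<open>-1\<close> as the start of the first gap, which stands for \<open>n - 1\<close>.
  The position of an element never exceeds three times the number of elements up to it. Only a gap
  of length 4 can break this, and only after an element where equality holds. Such an element
  remembers that, going back from it, all gaps have length 3 until one of length 4 is reached; the
  hypothesis \<open>hit\<close> rules out another gap of length 4 there.
\<close>

lemma hitting_set_card_bound:
  fixes A :: "int set" and n :: int
  assumes n: "n \<ge> 1" and A: "A \<subseteq> {0..<n}" and last: "n - 1 \<in> A"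
    and hit: "\<And>a j. 0 \<le> a \<Longrightarrow> 1 \<le> j \<Longrightarrow> a + 3 * j < n \<Longrightarrow>
      \<exists>p\<in>A. a \<le> p \<and> p \<le> a + 3 * j \<and> (p = a \<or> p = a + 3 * j \<or> \<not> 3 dvd p - a)"
  shows "n - 1 \<le> 3 * int (card A)"
proof -
  have fin: "finite A"
    using A finite_subset by blast
  define c where "c q = int (card {r \<in> A. r \<le> q})" for q
  \<comment> \<open>Here \<open>y\<close> is three before the end of the last gap of length 4, so it lies in that gap, and it is the
    left end of the arc that \<open>hit\<close> is applied to.\<close>
  define tight where "tight q \<longleftrightarrow>
    (\<exists>y. 0 \<le> y \<and> y < q \<and> 3 dvd q - y \<and> (\<forall>r\<in>A. y \<le> r \<longrightarrow> r \<le> q \<longrightarrow> y < r \<and> 3 dvd r - y))" for q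
  have main: "p \<le> 3 * c p \<and> (p = 3 * c p \<longrightarrow> tight p)" if "p \<in> insert (-1) A" for p
    using that
  proof (induction "nat (p + 1)" arbitrary: p rule: less_induct)
    case less
    show ?case
    proof (cases "p = -1")
      case True
      have no_neg: "{r \<in> A. r \<le> -1} = {}"
        using A by force
      have "c p = 0"
        unfolding c_def True no_neg by simp
      then show ?thesis
        using True by simp
    next
      case False
      then have pA: "p \<in> A"
        using less.prems by simp
      then have p: "0 \<le> p" "p < n"
        using A by auto
      define B where "B = insert (-1) {r \<in> A. r < p}"
      define q where "q = Max B"
      have B: "finite B" "B \<noteq> {}"
        using fin by (auto simp: B_def)
      have "q \<in> B"
        unfolding q_def using B by (rule Max_in)
      then have q: "q \<in> insert (-1) A" "q < p" "-1 \<le> q"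
        using p A by (auto simp: B_def)
      have between: "r \<le> q" if "r \<in> A" "r < p" for r
        unfolding q_def using B that by (auto simp: B_def)
      have "{r \<in> A. r \<le> p} = insert p {r \<in> A. r \<le> q}"
        using between q(2) pA by force
      moreover have "p \<notin> {r \<in> A. r \<le> q}"
        using q(2) by simp
      ultimately have cp: "c p = c q + 1"
        using fin by (simp add: c_def)
      have IH: "q \<le> 3 * c q" "q = 3 * c q \<Longrightarrow> tight q"
        using less.hyps[of q] q by auto
      have "p - q \<le> 4"
      proof (rule ccontr)
        assume "\<not> p - q \<le> 4"
        then obtain r where "r \<in> A" "q + 1 \<le> r" "r \<le> q + 4" "r < p"
          using hit[of "q + 1" 1] q p by fastforce
        then show False
          using between[of r] by simp
      qed
      then consider "p - q \<le> 2" | "p - q = 3" | "p - q = 4"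
        using q(2) by linarith
      then show ?thesis
      proof cases
        \<comment> \<open>A short gap restores strict inequality, a gap of length 3 preserves the state.\<close>
        case 1
        then show ?thesis
          using IH cp by simp
      next
        case 2
        have "tight p" if "p = 3 * c p"
        proof -
          have "q = 3 * c q"
            using that 2 cp by simp
          then obtain y where y: "0 \<le> y" "y < q" "3 dvd q - y"
            "\<forall>r\<in>A. y \<le> r \<longrightarrow> r \<le> q \<longrightarrow> y < r \<and> 3 dvd r - y"
            using IH(2) unfolding tight_def by blast
          have py: "3 dvd p - y"
            using y(3) 2 by presburger
          have "y < r \<and> 3 dvd r - y" if "r \<in> A" "y \<le> r" "r \<le> p" for r
            using that y py between[of r] q(2) by (cases "r = p") auto
          then show ?thesis
            using y py q(2) unfolding tight_def by (intro exI[of _ y]) auto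
        qed
        then show ?thesis
          using IH cp 2 by simp
      next
        case 3
        have dvd: "3 dvd p - (q + 1)"
          using 3 by presburger
        have "q \<noteq> 3 * c q"
        proof
          assume "q = 3 * c q"
          then obtain y where y: "0 \<le> y" "y < q" "3 dvd q - y"
            "\<forall>r\<in>A. y \<le> r \<longrightarrow> r \<le> q \<longrightarrow> y < r \<and> 3 dvd r - y"
            using IH(2) unfolding tight_def by blast
          \<comment> \<open>\<open>q + 3 = p - 1\<close> still lies in the gap after \<open>q\<close>.\<close>
          define j where "j = (q + 3 - y) div 3"
          have j: "y + 3 * j = q + 3" "1 \<le> j"
            using y(2,3) unfolding j_def by presburger+
          then obtain r where r: "r \<in> A" "y \<le> r" "r \<le> q + 3"
            "r = y \<or> r = q + 3 \<or> \<not> 3 dvd r - y"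
            using hit[of y j] y(1) 3 p by auto
          then have "r \<le> q"
            using between[of r] 3 by simp
          then show False
            using r y(4) by force
        qed
        moreover have "tight p"
          unfolding tight_def
        proof (intro exI[of _ "q + 1"] conjI ballI impI)
          fix r assume "r \<in> A" "q + 1 \<le> r" "r \<le> p"
          then have "r = p"
            using between[of r] by fastforce
          then show "q + 1 < r" "3 dvd r - (q + 1)"
            using 3 dvd by simp_all
        qed (use 3 q dvd in auto)
        ultimately show ?thesis
          using IH(1) cp 3 by linarith
      qed
    qed
  qed
  have "{r \<in> A. r \<le> n - 1} = A"
    using A by auto
  then show ?thesis
    using main[of "n - 1"] last by (simp add: c_def)
qed

section \<open>Resolving sets of the Andrasfai graph\<close>

text \<open>
  The element of \<open>W\<close> that separates \<open>a\<close> from \<open>a + 3 * j\<close> must lie at such an offset \<open>p\<close>: beyond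
  \<open>3 * j\<close> the two offsets \<open>p\<close> and \<open>p - 3 * j\<close> have the same residue modulo 3, and at an interior
  multiple of 3 they are 0 and, after adding \<open>n\<close>, 2 modulo 3, neither of which means adjacency.
\<close>

lemma resolving_set_hits_progression:
  fixes a j :: int
  assumes k: "k \<ge> 1" and W: "graph.resolving_set (Andrasfai_graph k) W"
    and j: "1 \<le> j" "3 * j < 3 * int k - 1"
  shows "\<exists>p. 0 \<le> p \<and> p \<le> 3 * j \<and> (a + p) mod (3 * int k - 1) \<in> W \<and>
    (p = 0 \<or> p = 3 * j \<or> \<not> 3 dvd p)"
proof -
  let ?G = "Andrasfai_graph k"
  define n where "n = 3 * int k - 1"
  interpret graph ?G
    using graph_Andrasfai_graph[OF k] .
  have V: "verts ?G = {0..<n}"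
    using verts_Andrasfai_graph[OF k] by (simp add: n_def)
  have n: "n > 0"
    using k by (simp add: n_def)
  note dist = Andrasfai_distance[OF k, folded n_def]
  define u v where "u = a mod n" and "v = (a + 3 * j) mod n"
  have uv: "u \<in> verts ?G" "v \<in> verts ?G"
    using n by (auto simp: u_def v_def V)
  have "u \<noteq> v"
  proof
    assume "u = v"
    then have "n dvd 3 * j"
      by (simp add: u_def v_def mod_eq_dvd_iff dvd_minus_iff)
    then show False
      using zdvd_imp_le[of n "3 * j"] j by (simp add: n_def)
  qed
  then obtain t where t: "t \<in> W" "distance u t \<noteq> distance v t"
    using W uv unfolding resolving_set_def by blast
  have tV: "t \<in> verts ?G"
    using t W unfolding resolving_set_def by blast
  define p where "p = (t - a) mod n"
  have p: "0 \<le> p" "p < n"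
    using n by (auto simp: p_def)
  have tp: "(a + p) mod n = t"
    using tV by (simp add: p_def V mod_simps)
  have offu: "(t - u) mod n = p"
    by (simp add: u_def p_def mod_simps)
  have offv: "(t - v) mod n = (p - 3 * j) mod n"
    by (simp add: v_def p_def mod_simps algebra_simps)
  have "p \<le> 3 * j \<and> (p = 0 \<or> p = 3 * j \<or> \<not> 3 dvd p)"
  proof (rule ccontr)
    assume neg: "\<not> ?thesis"
    have "p \<noteq> 0" "p \<noteq> 3 * j"
      using neg j by auto
    then have "\<not> n dvd p - 3 * j"
      using zdvd_imp_le[of n "p - 3 * j"] zdvd_imp_le[of n "3 * j - p"] p j \<open>p \<noteq> 3 * j\<close>
      by (cases "p < 3 * j") (auto simp: n_def dvd_diff_commute)
    then have "t \<noteq> u" "t \<noteq> v"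
      using offu offv \<open>p \<noteq> 0\<close> by (auto simp: mod_eq_0_iff_dvd)
    moreover have "p mod 3 = 1 \<longleftrightarrow> (p - 3 * j) mod n mod 3 = 1"
    proof (cases "p > 3 * j")
      case True
      then have off: "(p - 3 * j) mod n = p - 3 * j"
        using p j by simp
      show ?thesis
        unfolding off by presburger
    next
      case False
      then have "3 dvd p" "p < 3 * j"
        using neg \<open>p \<noteq> 3 * j\<close> by auto
      then have off: "(p - 3 * j) mod n = p - 3 * j + n"
        using p j by (intro mod_eq_add_modulus) (simp_all add: n_def)
      show ?thesis
        using \<open>3 dvd p\<close> unfolding off unfolding n_def by presburger
    qed
    ultimately have "distance u t = distance v t"
      using dist[OF uv(1) tV] dist[OF uv(2) tV] offu offv by simp
    then show False
      using t by simp
  qed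
  then show ?thesis
    using p t tp unfolding n_def by blast
qed

lemma resolving_set_card_ge:
  assumes k: "k \<ge> 1" and W: "graph.resolving_set (Andrasfai_graph k) W"
  shows "k \<le> card W"
proof -
  let ?G = "Andrasfai_graph k"
  define n where "n = 3 * int k - 1"
  interpret graph ?G
    using graph_Andrasfai_graph[OF k] .
  have V: "verts ?G = {0..<n}"
    using verts_Andrasfai_graph[OF k] by (simp add: n_def)
  have n: "n \<ge> 2"
    using k by (simp add: n_def)
  have WV: "W \<subseteq> {0..<n}"
    using W V unfolding resolving_set_def by simp
  then have "finite W"
    using finite_subset by blast
  have "0 \<in> verts ?G" "1 \<in> verts ?G"
    using n by (auto simp: V)
  then obtain w where w: "w \<in> W"
    using W zero_neq_one unfolding resolving_set_def by blast
  \<comment> \<open>Rotate \<open>W\<close> so that one of its elements comes to the last position \<open>n - 1\<close>.\<close>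
  define A where "A = {p \<in> {0..<n}. (w + 1 + p) mod n \<in> W}"
  have "inj_on (\<lambda>p. (w + 1 + p) mod n) A"
  proof
    fix p q assume pq: "p \<in> A" "q \<in> A" "(w + 1 + p) mod n = (w + 1 + q) mod n"
    then have "p mod n = q mod n"
      by (simp add: mod_eq_dvd_iff)
    then show "p = q"
      using pq by (simp add: A_def)
  qed
  then have "card A \<le> card W"
    using \<open>finite W\<close> by (intro card_inj_on_le) (auto simp: A_def)
  moreover have "n - 1 \<le> 3 * int (card A)"
  proof (rule hitting_set_card_bound)
    show "n - 1 \<in> A"
      using w WV n by (auto simp: A_def)
    fix a j :: int
    assume a: "0 \<le> a" and j: "1 \<le> j" and aj: "a + 3 * j < n"
    then obtain p where "0 \<le> p" "p \<le> 3 * j" "(w + 1 + a + p) mod n \<in> W"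
      "p = 0 \<or> p = 3 * j \<or> \<not> 3 dvd p"
      using resolving_set_hits_progression[OF k W j, of "w + 1 + a"] unfolding n_def by auto
    then show "\<exists>p\<in>A. a \<le> p \<and> p \<le> a + 3 * j \<and> (p = a \<or> p = a + 3 * j \<or> \<not> 3 dvd p - a)"
      using a aj by (intro bexI[of _ "a + p"]) (auto simp: A_def add_ac)
  qed (use n in \<open>auto simp: A_def\<close>)
  ultimately show ?thesis
    unfolding n_def by linarith
qed

text \<open>
  In cyclic order the gaps of this set are \<open>k - 1\<close> times 3 and once 2. The gap of length 2, across 0,
  makes vertices of residue 1 and those of residue 2 swap roles on the two sides of a landmark.
\<close>

lemma resolving_set_multiples_of_three:
  assumes k: "k \<ge> 1"
  shows "graph.resolving_set (Andrasfai_graph k) ((\<lambda>i. 3 * int i) ` {..<k})"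
proof -
  let ?G = "Andrasfai_graph k" and ?W = "(\<lambda>i. 3 * int i) ` {..<k}"
  define n where "n = 3 * int k - 1"
  interpret graph ?G
    using graph_Andrasfai_graph[OF k] .
  have V: "verts ?G = {0..<n}"
    using verts_Andrasfai_graph[OF k] by (simp add: n_def)
  note dist = Andrasfai_distance[OF k, folded n_def]
  have W: "t \<in> ?W \<longleftrightarrow> 0 \<le> t \<and> t < n \<and> t mod 3 = 0" for t
  proof
    assume "0 \<le> t \<and> t < n \<and> t mod 3 = 0"
    then have "t = 3 * int (nat (t div 3)) \<and> nat (t div 3) < k"
      unfolding n_def by (auto simp: nat_less_iff)
    then show "t \<in> ?W"
      by blast
  qed (auto simp: n_def)
  have off: "(t - u) mod n = (if u \<le> t then t - u else t - u + n)"
    if "u \<in> {0..<n}" "t \<in> {0..<n}" for t u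
    using that by (auto simp: mod_eq_add_modulus)
  have sub: "?W \<subseteq> verts ?G"
    using W unfolding V by (meson atLeastLessThan_iff subsetI)
  have n3: "n mod 3 = 2"
    unfolding n_def by presburger
  have resolved: "\<exists>t\<in>?W. distance u t \<noteq> distance v t"
    if u: "u \<in> verts ?G" and v: "v \<in> verts ?G" and uv: "u < v" for u v
  proof -
    have bounds: "0 \<le> u" "v < n"
      using u v V by auto
    have dist_cases: "distance x t = (if x = t then 0
        else if (if x \<le> t then (t - x) mod 3 else (t - x + 2) mod 3) = 1 then 1 else 2)"
      if x: "x \<in> verts ?G" and t: "t \<in> ?W" for x t
    proof -
      have "(t - x + n) mod 3 = (t - x + 2) mod 3"
        using n3 by presburger
      then show ?thesis
        using dist[of x t] off[of x t] x t sub V by auto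
    qed
    have residues: "x mod 3 = 0 \<or> x mod 3 = 1 \<or> x mod 3 = 2" for x :: int
      by presburger
    consider "u mod 3 = 0" | "v mod 3 = 0" | "u mod 3 = 1" "v mod 3 = 2" | "u mod 3 = 2" "v mod 3 = 1"
      | "u mod 3 = 1" "v mod 3 = 1" | "u mod 3 = 2" "v mod 3 = 2"
      using residues[of u] residues[of v] by blast
    then show ?thesis
    proof cases
      \<comment> \<open>A member of the set is the only vertex at distance 0 from itself.\<close>
      case 1
      then have "u \<in> ?W"
        using bounds uv W by simp
      then show ?thesis
        using dist_cases[OF u] dist_cases[OF v] uv by (intro bexI[of _ u]) auto
    next
      case 2
      then have "v \<in> ?W"
        using bounds uv W by simp
      then show ?thesis
        using dist_cases[OF u] dist_cases[OF v] uv by (intro bexI[of _ v]) auto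
    next
      case 3
      have 0: "0 \<in> ?W"
        using bounds uv W by simp
      have "\<not> u \<le> 0" "\<not> v \<le> 0"
        using 3 bounds uv by force+
      moreover have "(0 - u + 2) mod 3 = 1" "(0 - v + 2) mod 3 \<noteq> 1"
        using 3 by presburger+
      ultimately have "distance u 0 = 1" "distance v 0 = 2"
        using dist_cases[OF u 0] dist_cases[OF v 0] by auto
      then show ?thesis
        using 0 by (intro bexI[of _ 0]) auto
    next
      case 4
      have 0: "0 \<in> ?W"
        using bounds uv W by simp
      have "\<not> u \<le> 0" "\<not> v \<le> 0"
        using 4 bounds uv by force+
      moreover have "(0 - u + 2) mod 3 \<noteq> 1" "(0 - v + 2) mod 3 = 1"
        using 4 by presburger+
      ultimately have "distance u 0 = 2" "distance v 0 = 1"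
        using dist_cases[OF u 0] dist_cases[OF v 0] by auto
      then show ?thesis
        using 0 by (intro bexI[of _ 0]) auto
    next
      case 5
      \<comment> \<open>In this case and the next, the largest multiple of 3 up to \<open>v\<close> lies strictly between
        \<open>u\<close> and \<open>v\<close>, and so it sees their common residue from opposite sides.\<close>
      define t where "t = v - 1"
      have apart: "u + 3 \<le> v"
        using uv 5 by presburger
      have 0: "(v - 1) mod 3 = 0"
        using 5 by presburger
      have t: "t \<in> ?W"
        unfolding W t_def using bounds uv apart 0 by simp
      have "u < t" "\<not> v \<le> t"
        using apart by (simp_all add: t_def)
      moreover have "(t - u) mod 3 \<noteq> 1" "(t - v + 2) mod 3 = 1"
        using 5 unfolding t_def by presburger+
      ultimately have "distance u t = 2" "distance v t = 1"
        using dist_cases[OF u t] dist_cases[OF v t] by auto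
      then show ?thesis
        using t by (intro bexI[of _ t]) auto
    next
      case 6
      define t where "t = v - 2"
      have apart: "u + 3 \<le> v"
        using uv 6 by presburger
      have 0: "(v - 2) mod 3 = 0"
        using 6 by presburger
      have t: "t \<in> ?W"
        unfolding W t_def using bounds uv apart 0 by simp
      have "u < t" "\<not> v \<le> t"
        using apart by (simp_all add: t_def)
      moreover have "(t - u) mod 3 = 1" "(t - v + 2) mod 3 \<noteq> 1"
        using 6 unfolding t_def by presburger+
      ultimately have "distance u t = 1" "distance v t = 2"
        using dist_cases[OF u t] dist_cases[OF v t] by auto
      then show ?thesis
        using t by (intro bexI[of _ t]) auto
    qed
  qed
  show ?thesis
    unfolding resolving_set_def using sub resolved by (metis linorder_neq_iff)
qed

theorem theorem2p1:
  fixes k :: nat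
  assumes "k \<ge> 1"
  shows "graph.metric_dimension (Andrasfai_graph k) = k"
proof -
  interpret graph "Andrasfai_graph k"
    using graph_Andrasfai_graph[OF assms] .
  have "card ((\<lambda>i. 3 * int i) ` {..<k}) = k"
    by (simp add: card_image inj_on_def)
  then show ?thesis
    unfolding metric_dimension_def
    using resolving_set_multiples_of_three[OF assms] resolving_set_card_ge[OF assms]
    by (intro Least_equality) blast+
qed

end
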